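(* The space $(\mathrm{Dgm}_\infty,w_\infty)$ of persistence diagrams with the bottleneck distance has infinite asymptotic dimension; that is, there is no non-negative integer $n$ such that $(\mathrm{Dgm}_\infty,w_\infty)$ has asymptotic dimension $\le n$.
   Context: Let $\mathbb{R}^2_< = \{(x,y)\in\mathbb{R}^2 : x<y\}$ with metric $d_\infty(a,b)=\|a-b\|_\infty=\max(|a_x-b_x|,|a_y-b_y|)$, and let $\Delta$ be the diagonal in $\mathbb{R}^2$; for $a\in\mathbb{R}^2_<$, $d_\infty(a,\Delta)=\inf_{t\in\Delta}\|a-t\|_\infty=(a_y-a_x)/2$. A persistence diagram is a function $D:I\to\mathbb{R}^2_<$ with $I$ a countable (possibly finite or empty) set; $\emptyset$ denotes the diagram with empty index set. A partial matching between $D_1:I_1\to\mathbb{R}^2_<$ and $D_2:I_2\to\mathbb{R}^2_<$ is a triple $(I_1',I_2',f)$ with $I_1'\subseteq I_1$, $I_2'\subseteq I_2$ and $f:I_1'\to I_2'$ a bijection. Its $\infty$-cost is $$\mathrm{cost}_\infty(f)=\max\Big\{\sup_{i\in I_1'}d_\infty(D_1(i),D_2(f(i))),\ \sup_{i\in I_1\setminus I_1'}d_\infty(D_1(i),\Delta),\ \sup_{i\in I_2\setminus I_2'}d_\infty(D_2(i),\Delta)\Big\}\in[0,\infty]$$ (suprema over empty sets are $0$). Put $\tilde w_\infty(D_1,D_2)=\inf\{\mathrm{cost}_\infty(f)\}$ over all partial matchings between $D_1$ and $D_2$. The space $(\mathrm{Dgm}_\infty,w_\infty)$ is the set of persistence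 diagrams $D$ with $\tilde w_\infty(D,\emptyset)<\infty$, modulo the relation $D_1\sim D_2$ iff $\tilde w_\infty(D_1,D_2)=0$, with the induced metric $w_\infty$ (the bottleneck distance). For a non-negative integer $n$, a metric space $(X,d)$ has asymptotic dimension $\le n$ if for every $R>0$ there exists a cover $\mathcal{U}$ of $X$ such that every ball of radius $R$ intersects at most $n+1$ elements of $\mathcal{U}$ and $\sup_{U\in\mathcal{U}}\sup\{d(x,y) : x,y\in U\}<\infty$. *)

theory Defs
  imports "HOL-Analysis.Analysis"
begin

section \<open>Persistence diagrams\<close>

definition half_plane :: "(real \<times> real) set" where
  "half_plane = {(x, y). x < y}"

definition diagonal :: "(real \<times> real) set" where
  "diagonal = {(x, y). x = y}"

text \<open>The distance that the type class provides on pairs is the Euclidean one, so the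
  maximum metric is introduced separately.\<close>

definition d_inf :: "real \<times> real \<Rightarrow> real \<times> real \<Rightarrow> real" where
  "d_inf a b = max \<bar>fst a - fst b\<bar> \<bar>snd a - snd b\<bar>"

definition d_inf_diag :: "real \<times> real \<Rightarrow> real" where
  "d_inf_diag a = (INF t\<in>diagonal. d_inf a t)"

text \<open>A diagram is a partial function whose domain is the index set; \<^term>\<open>Map.empty\<close> is the
  diagram with empty index set.\<close>

type_synonym 'i diagram = "'i \<Rightarrow> (real \<times> real) option"

definition persistence_diagram :: "'i diagram \<Rightarrow> bool" where
  "persistence_diagram D \<longleftrightarrow> countable (dom D) \<and> ran D \<subseteq> half_plane"

definition pt :: "'i diagram \<Rightarrow> 'i \<Rightarrow> real \<times> real" where
  "pt D i = the (D i)"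

definition partial_matching ::
  "'i diagram \<Rightarrow> 'j diagram \<Rightarrow> 'i set \<times> 'j set \<times> ('i \<Rightarrow> 'j) \<Rightarrow> bool" where
  "partial_matching D1 D2 = (\<lambda>(I1, I2, f). I1 \<subseteq> dom D1 \<and> I2 \<subseteq> dom D2 \<and> bij_betw f I1 I2)"

text \<open>In \<^typ>\<open>ennreal\<close> the supremum of the empty set is 0.\<close>

definition cost_inf ::
  "'i diagram \<Rightarrow> 'j diagram \<Rightarrow> 'i set \<times> 'j set \<times> ('i \<Rightarrow> 'j) \<Rightarrow> ennreal" where
  "cost_inf D1 D2 = (\<lambda>(I1, I2, f).
     Max {SUP i\<in>I1. ennreal (d_inf (pt D1 i) (pt D2 (f i))),
          SUP i\<in>dom D1 - I1. ennreal (d_inf_diag (pt D1 i)),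
          SUP j\<in>dom D2 - I2. ennreal (d_inf_diag (pt D2 j))})"

definition pre_bottleneck :: "'i diagram \<Rightarrow> 'j diagram \<Rightarrow> ennreal" where
  "pre_bottleneck D1 D2 = (INF m\<in>{m. partial_matching D1 D2 m}. cost_inf D1 D2 m)"


section \<open>The space of persistence diagrams with the bottleneck distance\<close>

text \<open>Every diagram with a countable index set can be reindexed by natural numbers without leaving
  its equivalence class (lemma \<open>diagram_reindex_nat\<close> below), so that the index type \<^typ>\<open>nat\<close>
  represents all diagrams.\<close>

definition finite_diagrams :: "nat diagram set" where
  "finite_diagrams =
     {D. persistence_diagram D \<and> pre_bottleneck D (Map.empty :: nat diagram) < \<infinity>}"

definition diagram_rel :: "(nat diagram \<times> nat diagram) set" where
  "diagram_rel =
     {(D1, D2). D1 \<in> finite_diagrams \<and> D2 \<in> finite_diagrams \<and> pre_bottleneck D1 D2 = 0}"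

definition Dgm_inf :: "nat diagram set set" where
  "Dgm_inf = finite_diagrams // diagram_rel"

text \<open>The value does not depend on the chosen representatives (lemma \<open>bottleneck_class\<close> below).\<close>

definition bottleneck :: "nat diagram set \<Rightarrow> nat diagram set \<Rightarrow> real" where
  "bottleneck X Y = enn2real (pre_bottleneck (SOME D. D \<in> X) (SOME D. D \<in> Y))"


section \<open>Asymptotic dimension\<close>

context Metric_space
begin

definition asdim_le :: "nat \<Rightarrow> bool" where
  "asdim_le n \<longleftrightarrow>
     (\<forall>R>0. \<exists>\<U>. \<U> \<subseteq> Pow M \<and> \<Union>\<U> = M \<and>
        (\<forall>x\<in>M. finite {U\<in>\<U>. U \<inter> mball x R \<noteq> {}} \<and> card {U\<in>\<U>. U \<inter> mball x R \<noteq> {}} \<le> n + 1) \<and>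
        (SUP U\<in>\<U>. SUP x\<in>U. SUP y\<in>U. ennreal (d x y)) < \<infinity>)"

end


section \<open>The bottleneck distance is a well-defined metric\<close>

lemma d_inf_nonneg: "0 \<le> d_inf a b"
  by (simp add: d_inf_def)

lemma d_inf_commute: "d_inf a b = d_inf b a"
  by (simp add: d_inf_def abs_minus_commute)

lemma d_inf_triangle: "d_inf a c \<le> d_inf a b + d_inf b c"
  unfolding d_inf_def by linarith

lemma d_inf_diag_eq: "d_inf_diag a = \<bar>snd a - fst a\<bar> / 2"
  unfolding d_inf_diag_def
proof (rule cInf_eq_minimum)
  let ?m = "(fst a + snd a) / 2"
  have "d_inf a (?m, ?m) = \<bar>snd a - fst a\<bar> / 2"
    unfolding d_inf_def fst_conv snd_conv by (simp add: field_simps abs_if max_def)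
  then show "\<bar>snd a - fst a\<bar> / 2 \<in> d_inf a ` diagonal"
    by (metis (mono_tags, lifting) case_prodI diagonal_def image_eqI mem_Collect_eq)
next
  fix x assume "x \<in> d_inf a ` diagonal"
  then obtain t where "x = max \<bar>fst a - t\<bar> \<bar>snd a - t\<bar>"
    by (auto simp: diagonal_def d_inf_def)
  then have "\<bar>fst a - t\<bar> \<le> x" "\<bar>snd a - t\<bar> \<le> x"
    by simp_all
  moreover have "\<bar>snd a - fst a\<bar> \<le> \<bar>fst a - t\<bar> + \<bar>snd a - t\<bar>"
    by arith
  ultimately show "\<bar>snd a - fst a\<bar> / 2 \<le> x"
    by (simp add: field_simps)
qed

lemma d_inf_diag_nonneg: "0 \<le> d_inf_diag a"
  by (simp add: d_inf_diag_eq)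

lemma d_inf_diag_half_plane:
  assumes "a \<in> half_plane"
  shows "d_inf_diag a = (snd a - fst a) / 2"
  using assms by (auto simp: d_inf_diag_eq half_plane_def)

lemma d_inf_diag_triangle: "d_inf_diag a \<le> d_inf a b + d_inf_diag b"
proof -
  have "\<bar>fst a - fst b\<bar> \<le> d_inf a b" "\<bar>snd a - snd b\<bar> \<le> d_inf a b"
    by (simp_all add: d_inf_def)
  moreover have
    "\<bar>snd a - fst a\<bar> \<le> \<bar>fst a - fst b\<bar> + \<bar>snd a - snd b\<bar> + \<bar>snd b - fst b\<bar>"
    by arith
  ultimately show ?thesis
    unfolding d_inf_diag_eq by (simp add: field_simps)
qed

lemma cost_inf_le_iff:
  "cost_inf D1 D2 (I1, I2, f) \<le> c \<longleftrightarrow>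
     (\<forall>i\<in>I1. ennreal (d_inf (pt D1 i) (pt D2 (f i))) \<le> c) \<and>
     (\<forall>i\<in>dom D1 - I1. ennreal (d_inf_diag (pt D1 i)) \<le> c) \<and>
     (\<forall>j\<in>dom D2 - I2. ennreal (d_inf_diag (pt D2 j)) \<le> c)"
  unfolding cost_inf_def by (simp add: SUP_le_iff)

lemma pre_bottleneck_le:
  assumes "partial_matching D1 D2 m" and "cost_inf D1 D2 m \<le> c"
  shows "pre_bottleneck D1 D2 \<le> c"
  unfolding pre_bottleneck_def using assms by (intro INF_lower2[of m]) auto

lemma pre_bottleneck_refl: "pre_bottleneck D D = 0"
proof -
  have "pre_bottleneck D D \<le> 0"
  proof (rule pre_bottleneck_le)
    show "partial_matching D D (dom D, dom D, id)"
      by (simp add: partial_matching_def)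
    show "cost_inf D D (dom D, dom D, id) \<le> 0"
      unfolding cost_inf_le_iff by (simp add: d_inf_def)
  qed
  then show ?thesis by simp
qed

lemma pre_bottleneck_commute_le: "pre_bottleneck D2 D1 \<le> pre_bottleneck D1 D2"
  unfolding pre_bottleneck_def[of D1]
proof (rule INF_greatest)
  fix m assume "m \<in> {m. partial_matching D1 D2 m}"
  then obtain A B f where m: "m = (A, B, f)" "A \<subseteq> dom D1" "B \<subseteq> dom D2" "bij_betw f A B"
    by (cases m) (auto simp: partial_matching_def)
  let ?g = "inv_into A f"
  have g: "bij_betw ?g B A"
    using m by (simp add: bij_betw_inv_into)
  have gB: "?g j \<in> A \<and> f (?g j) = j" if "j \<in> B" for j
    using that m(4) g by (metis bij_betwE bij_betw_inv_into_right)
  have c: "cost_inf D1 D2 (A, B, f) \<le> cost_inf D1 D2 m" using m(1) by simp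
  show "pre_bottleneck D2 D1 \<le> cost_inf D1 D2 m"
  proof (rule pre_bottleneck_le)
    show "partial_matching D2 D1 (B, A, ?g)"
      using m g by (simp add: partial_matching_def)
    show "cost_inf D2 D1 (B, A, ?g) \<le> cost_inf D1 D2 m"
      unfolding cost_inf_le_iff
    proof (intro conjI ballI)
      fix j assume "j \<in> B"
      then have "ennreal (d_inf (pt D1 (?g j)) (pt D2 (f (?g j)))) \<le> cost_inf D1 D2 m"
        using c gB unfolding cost_inf_le_iff by blast
      then show "ennreal (d_inf (pt D2 j) (pt D1 (?g j))) \<le> cost_inf D1 D2 m"
        using gB[OF \<open>j \<in> B\<close>] by (simp add: d_inf_commute[of "pt D2 j"])
    qed (use c in \<open>auto simp: cost_inf_le_iff\<close>)
  qed
qed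

lemma pre_bottleneck_commute: "pre_bottleneck D1 D2 = pre_bottleneck D2 D1"
  by (intro antisym pre_bottleneck_commute_le)

lemma pre_bottleneck_triangle_matching:
  assumes "partial_matching D1 D2 m" and "partial_matching D2 D3 n"
  shows "pre_bottleneck D1 D3 \<le> cost_inf D1 D2 m + cost_inf D2 D3 n"
proof -
  obtain A B f where m: "m = (A, B, f)" "A \<subseteq> dom D1" "B \<subseteq> dom D2" "bij_betw f A B"
    using assms(1) by (cases m) (auto simp: partial_matching_def)
  obtain B' C g where n: "n = (B', C, g)" "B' \<subseteq> dom D2" "C \<subseteq> dom D3" "bij_betw g B' C"
    using assms(2) by (cases n) (auto simp: partial_matching_def)
  define c e where "c = cost_inf D1 D2 m" and "e = cost_inf D2 D3 n"
  have "cost_inf D1 D2 (A, B, f) \<le> c" "cost_inf D2 D3 (B', C, g) \<le> e"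
    using m(1) n(1) by (simp_all add: c_def e_def)
  note c = this(1)[unfolded cost_inf_le_iff] and e = this(2)[unfolded cost_inf_le_iff]
  have sum: "ennreal r \<le> c + e"
    if "r \<le> s + t" "ennreal s \<le> c" "ennreal t \<le> e" "0 \<le> s" "0 \<le> t" for r s t
  proof -
    have "ennreal r \<le> ennreal s + ennreal t"
      using that(1,4,5) by (metis ennreal_leI ennreal_plus)
    then show ?thesis using add_mono[OF that(2,3)] by (rule order_trans)
  qed
  define A' where "A' = {i\<in>A. f i \<in> B'}"
  have finj: "inj_on f A" "f ` A = B" and ginj: "inj_on g B'" "g ` B' = C"
    using m(4) n(4) by (auto simp: bij_betw_def)
  have "pre_bottleneck D1 D3 \<le> c + e"
  proof (rule pre_bottleneck_le)
    have "inj_on (g \<circ> f) A'"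
      using finj ginj by (auto simp: A'_def inj_on_def)
    then show "partial_matching D1 D3 (A', (g \<circ> f) ` A', g \<circ> f)"
      using m(2) n(3) ginj(2) by (auto simp: partial_matching_def A'_def bij_betw_def)
    show "cost_inf D1 D3 (A', (g \<circ> f) ` A', g \<circ> f) \<le> c + e"
      unfolding cost_inf_le_iff
    proof (intro conjI ballI)
      fix i assume "i \<in> A'"
      then show "ennreal (d_inf (pt D1 i) (pt D3 ((g \<circ> f) i))) \<le> c + e"
        unfolding A'_def comp_def using c e
        by (intro sum[OF d_inf_triangle[of _ _ "pt D2 (f i)"]]) (auto simp: d_inf_nonneg)
    next
      fix i assume i: "i \<in> dom D1 - A'"
      show "ennreal (d_inf_diag (pt D1 i)) \<le> c + e"
      proof (cases "i \<in> A")
        case True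
        then have "f i \<in> dom D2 - B'" using i m(3) finj by (auto simp: A'_def)
        then show ?thesis using True c e
          by (intro sum[OF d_inf_diag_triangle[of _ "pt D2 (f i)"]])
            (auto simp: d_inf_nonneg d_inf_diag_nonneg)
      next
        case False
        then have "ennreal (d_inf_diag (pt D1 i)) \<le> c" using i c by blast
        then show ?thesis by (simp add: add_increasing2)
      qed
    next
      fix k assume k: "k \<in> dom D3 - (g \<circ> f) ` A'"
      show "ennreal (d_inf_diag (pt D3 k)) \<le> c + e"
      proof (cases "k \<in> C")
        case True
        then obtain j where j: "j \<in> B'" "k = g j" using ginj by auto
        then have "j \<in> dom D2 - B" using k n(2) finj by (force simp: A'_def)
        then have "ennreal (d_inf_diag (pt D2 j)) \<le> c" using c by blast
        moreover have "ennreal (d_inf (pt D2 j) (pt D3 k)) \<le> e" using e j by blast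
        moreover have "d_inf_diag (pt D3 k) \<le> d_inf_diag (pt D2 j) + d_inf (pt D2 j) (pt D3 k)"
          using d_inf_diag_triangle[of "pt D3 k" "pt D2 j"] by (simp add: d_inf_commute)
        ultimately show ?thesis
          using sum by (simp add: d_inf_nonneg d_inf_diag_nonneg)
      next
        case False
        then have "ennreal (d_inf_diag (pt D3 k)) \<le> e" using k e by blast
        then show ?thesis by (simp add: add_increasing)
      qed
    qed
  qed
  then show ?thesis by (simp add: c_def e_def)
qed

lemma pre_bottleneck_triangle:
  "pre_bottleneck D1 D3 \<le> pre_bottleneck D1 D2 + pre_bottleneck D2 D3"
proof (rule ennreal_le_epsilon)
  fix r :: real
  assume fin: "pre_bottleneck D1 D2 + pre_bottleneck D2 D3 < top" and r: "0 < r"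
  have "pre_bottleneck D1 D2 < pre_bottleneck D1 D2 + ennreal (r / 2)"
    and "pre_bottleneck D2 D3 < pre_bottleneck D2 D3 + ennreal (r / 2)"
    using fin r by (auto simp: ennreal_add_left_cancel_less)
  then obtain m n where
    m: "partial_matching D1 D2 m" "cost_inf D1 D2 m < pre_bottleneck D1 D2 + ennreal (r / 2)" and
    n: "partial_matching D2 D3 n" "cost_inf D2 D3 n < pre_bottleneck D2 D3 + ennreal (r / 2)"
    unfolding pre_bottleneck_def by (auto simp: INF_less_iff)
  have "pre_bottleneck D1 D3 \<le> cost_inf D1 D2 m + cost_inf D2 D3 n"
    using m n by (intro pre_bottleneck_triangle_matching)
  also have "\<dots> \<le> (pre_bottleneck D1 D2 + ennreal (r / 2)) + (pre_bottleneck D2 D3 + ennreal (r / 2))"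
    using m n by (intro add_mono) auto
  also have "\<dots> = pre_bottleneck D1 D2 + pre_bottleneck D2 D3 + (ennreal (r / 2) + ennreal (r / 2))"
    by (simp add: ac_simps)
  also have "ennreal (r / 2) + ennreal (r / 2) = ennreal r"
    using r by (simp flip: ennreal_plus)
  finally show "pre_bottleneck D1 D3 \<le> pre_bottleneck D1 D2 + pre_bottleneck D2 D3 + ennreal r" .
qed

lemma diagram_reindex_nat:
  fixes D :: "'i diagram"
  assumes "persistence_diagram D"
  shows "\<exists>D' :: nat diagram. persistence_diagram D' \<and> pre_bottleneck D D' = 0"
proof -
  let ?f = "to_nat_on (dom D)"
  define D' :: "nat diagram" where
    "D' = (\<lambda>n. if n \<in> ?f ` dom D then D (inv_into (dom D) ?f n) else None)"
  have inj: "inj_on ?f (dom D)"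
    using assms by (simp add: persistence_diagram_def inj_on_to_nat_on)
  have D': "D' (?f i) = D i" if "i \<in> dom D" for i
    using that inj by (simp add: D'_def)
  have dom: "dom D' = ?f ` dom D"
  proof
    show "dom D' \<subseteq> ?f ` dom D"
      by (auto simp: D'_def dom_def split: if_splits)
    show "?f ` dom D \<subseteq> dom D'"
      using D' by (fastforce simp: dom_def)
  qed
  have "ran D' \<subseteq> ran D"
    by (auto simp: D'_def ran_def split: if_splits)
  then have "persistence_diagram D'"
    using assms by (auto simp: persistence_diagram_def)
  moreover have "pre_bottleneck D D' \<le> 0"
  proof (rule pre_bottleneck_le)
    show "partial_matching D D' (dom D, dom D', ?f)"
      using inj by (simp add: partial_matching_def bij_betw_def dom)
    show "cost_inf D D' (dom D, dom D', ?f) \<le> 0"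
      unfolding cost_inf_le_iff by (simp add: pt_def d_inf_def D' dom)
  qed
  ultimately show ?thesis by auto
qed

lemma pre_bottleneck_finite:
  assumes "D1 \<in> finite_diagrams" and "D2 \<in> finite_diagrams"
  shows "pre_bottleneck D1 D2 < \<infinity>"
proof -
  let ?E = "Map.empty :: nat diagram"
  have "pre_bottleneck D1 D2 \<le> pre_bottleneck D1 ?E + pre_bottleneck ?E D2"
    by (rule pre_bottleneck_triangle)
  also have "\<dots> < \<infinity>"
    using assms by (simp add: finite_diagrams_def pre_bottleneck_commute[of ?E])
  finally show ?thesis .
qed

lemma equiv_diagram_rel: "equiv finite_diagrams diagram_rel"
proof (rule equivI)
  show "diagram_rel \<subseteq> finite_diagrams \<times> finite_diagrams"
    by (auto simp: diagram_rel_def)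
  show "refl_on finite_diagrams diagram_rel"
    by (auto simp: refl_on_def diagram_rel_def pre_bottleneck_refl)
  show "sym diagram_rel"
  proof (rule symI)
    fix D1 D2 assume "(D1, D2) \<in> diagram_rel"
    then show "(D2, D1) \<in> diagram_rel"
      using pre_bottleneck_commute[of D1 D2] by (simp add: diagram_rel_def)
  qed
  show "trans diagram_rel"
  proof (rule transI)
    fix D1 D2 D3 assume "(D1, D2) \<in> diagram_rel" "(D2, D3) \<in> diagram_rel"
    then have "D1 \<in> finite_diagrams" "D3 \<in> finite_diagrams"
      and "pre_bottleneck D1 D2 + pre_bottleneck D2 D3 = 0"
      by (simp_all add: diagram_rel_def)
    moreover from this(3) have "pre_bottleneck D1 D3 = 0"
      using pre_bottleneck_triangle[of D1 D3 D2] by (metis le_zero_eq)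
    ultimately show "(D1, D3) \<in> diagram_rel"
      by (simp add: diagram_rel_def)
  qed
qed

lemma pre_bottleneck_cong:
  assumes "(D1, E1) \<in> diagram_rel" and "(D2, E2) \<in> diagram_rel"
  shows "pre_bottleneck D1 D2 = pre_bottleneck E1 E2"
proof -
  have le: "pre_bottleneck D1 D2 \<le> pre_bottleneck E1 E2"
    if "(D1, E1) \<in> diagram_rel" "(D2, E2) \<in> diagram_rel" for D1 D2 E1 E2
  proof -
    have "pre_bottleneck D1 D2 \<le> pre_bottleneck D1 E1 + pre_bottleneck E1 D2"
      by (rule pre_bottleneck_triangle)
    also have "\<dots> \<le> pre_bottleneck D1 E1 + (pre_bottleneck E1 E2 + pre_bottleneck E2 D2)"
      by (intro add_left_mono pre_bottleneck_triangle)
    finally show ?thesis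
      using that by (simp add: diagram_rel_def pre_bottleneck_commute[of E2])
  qed
  show ?thesis
    using assms equiv_diagram_rel by (intro antisym le) (auto dest: equivE symD)
qed

lemma bottleneck_class:
  assumes "D1 \<in> finite_diagrams" and "D2 \<in> finite_diagrams"
  shows "bottleneck (diagram_rel `` {D1}) (diagram_rel `` {D2}) = enn2real (pre_bottleneck D1 D2)"
proof -
  have "(D, SOME E. E \<in> diagram_rel `` {D}) \<in> diagram_rel" if "D \<in> finite_diagrams" for D
  proof -
    have "D \<in> diagram_rel `` {D}"
      using that equiv_diagram_rel by (rule equiv_class_self[rotated])
    then have "(SOME E. E \<in> diagram_rel `` {D}) \<in> diagram_rel `` {D}"
      by (rule someI[of "\<lambda>E. E \<in> diagram_rel `` {D}"])
    then show ?thesis by simp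
  qed
  from pre_bottleneck_cong[OF this this, OF assms] show ?thesis
    by (simp only: bottleneck_def)
qed

theorem Metric_space_Dgm_inf: "Metric_space Dgm_inf bottleneck"
proof
  fix X Y
  show "0 \<le> bottleneck X Y"
    by (simp add: bottleneck_def)
  show "bottleneck X Y = bottleneck Y X"
    unfolding bottleneck_def by (rule arg_cong[OF pre_bottleneck_commute])
next
  fix X Y assume "X \<in> Dgm_inf" "Y \<in> Dgm_inf"
  then obtain D1 D2 where D: "D1 \<in> finite_diagrams" "X = diagram_rel `` {D1}"
    "D2 \<in> finite_diagrams" "Y = diagram_rel `` {D2}"
    unfolding Dgm_inf_def by (auto elim!: quotientE)
  then have "bottleneck X Y = 0 \<longleftrightarrow> pre_bottleneck D1 D2 = 0"
    using pre_bottleneck_finite[of D1 D2] by (auto simp: bottleneck_class enn2real_eq_0_iff)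
  also have "\<dots> \<longleftrightarrow> X = Y"
    using D by (simp add: eq_equiv_class_iff[OF equiv_diagram_rel]) (simp add: diagram_rel_def)
  finally show "bottleneck X Y = 0 \<longleftrightarrow> X = Y" .
next
  fix X Y Z assume "X \<in> Dgm_inf" "Y \<in> Dgm_inf" "Z \<in> Dgm_inf"
  then obtain D1 D2 D3 where D: "D1 \<in> finite_diagrams" "X = diagram_rel `` {D1}"
    "D2 \<in> finite_diagrams" "Y = diagram_rel `` {D2}" "D3 \<in> finite_diagrams" "Z = diagram_rel `` {D3}"
    unfolding Dgm_inf_def by (auto elim!: quotientE)
  have "enn2real (pre_bottleneck D1 D3) \<le> enn2real (pre_bottleneck D1 D2 + pre_bottleneck D2 D3)"
    using D pre_bottleneck_finite pre_bottleneck_triangle by (intro enn2real_mono) auto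
  also have "\<dots> = enn2real (pre_bottleneck D1 D2) + enn2real (pre_bottleneck D2 D3)"
    using D pre_bottleneck_finite by (intro enn2real_plus) auto
  finally show "bottleneck X Z \<le> bottleneck X Y + bottleneck Y Z"
    using D by (simp add: bottleneck_class)
qed

end

(*
  A diagram with n points that lie far from each other and from the diagonal, and whose second
  coordinates vary independently in an interval of length p, has only one cheap matching with
  another such diagram. Hence the cube {0..p}^n with the maximum metric embeds isometrically into
  the space of diagrams, for all n and p. Take n + 1 coordinates, and let p exceed the diameter of
  the sets of a cover of asymptotic dimension n. No set of the cover then meets two opposite
  faces of the cube, so by Lebesgue's covering theorem (here from Kuhn's combinatorial lemma) some
  unit cube of the grid meets n + 2 sets of the cover.
*)

theory Submission
  imports Defs
begin

text \<open>A discrete form of Lebesgue's covering theorem. The corner \<open>q\<close> is returned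
  with \<open>S\<close> because a ball around its image will have to meet all the colours
  found.\<close>

lemma grid_covering:
  fixes c :: "(nat \<Rightarrow> nat) \<Rightarrow> 'a" and n p :: nat
  assumes "0 < p"
    and opposite: "\<And>x y j. \<lbrakk>\<forall>i. x i \<le> p; \<forall>i. y i \<le> p; j < n; x j = 0; y j = p\<rbrakk> \<Longrightarrow> c x \<noteq> c y"
  obtains q S where "q \<in> S" "finite S" "\<And>x j. x \<in> S \<Longrightarrow> x j \<le> p"
    "\<And>x j. x \<in> S \<Longrightarrow> q j \<le> x j \<and> x j \<le> Suc (q j)" "Suc n \<le> card (c ` S)"
proof -
  text \<open>The label of a point depends only on its colour, so the \<open>n + 1\<close> different labels of a
    completely labelled simplex come from \<open>n + 1\<close> different colours.\<close>
  define L :: "'a \<Rightarrow> nat \<Rightarrow> nat" where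
    "L = (\<lambda>u j. if \<exists>y. (\<forall>i. y i \<le> p) \<and> c y = u \<and> y j = 0 then 0 else 1)"
  have "odd (card {S. ksimplex p n S \<and> (reduced n \<circ> (L \<circ> c)) ` S = {..n}})"
  proof (rule kuhn_combinatorial[OF \<open>0 < p\<close>])
    show "\<forall>x j. (\<forall>j. x j \<le> p) \<and> j < n \<and> x j = 0 \<longrightarrow> (L \<circ> c) x j = 0"
      by (auto simp: L_def)
    show "\<forall>x j. (\<forall>j. x j \<le> p) \<and> j < n \<and> x j = p \<longrightarrow> (L \<circ> c) x j = 1"
    proof (intro allI impI)
      fix x j assume x: "(\<forall>j. x j \<le> p) \<and> j < n \<and> x j = p"
      \<comment> \<open>By \<open>opposite\<close>, the colour of a point on the face
        \<open>x j = p\<close> never occurs on the face where coordinate \<open>j\<close> is 0, so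
        its label there is 1.\<close>
      then have "c y \<noteq> c x" if "\<forall>i. y i \<le> p" "y j = 0" for y
        using opposite[of y x j] that by simp
      then show "(L \<circ> c) x j = 1"
        by (auto simp: L_def)
    qed
  qed
  then have "{S. ksimplex p n S \<and> (reduced n \<circ> (L \<circ> c)) ` S = {..n}} \<noteq> {}"
    by (rule odd_card_imp_not_empty)
  then obtain S b u where simplex: "kuhn_simplex p n b u S"
    and labels: "(reduced n \<circ> (L \<circ> c)) ` S = {..n}"
    by (auto elim: ksimplex.cases)
  interpret kuhn_simplex p n b u S by fact
  have "finite S"
    by (simp add: s_eq)
  have "Suc n = card ((reduced n \<circ> L) ` (c ` S))"
    using labels by (simp add: image_comp comp_assoc)
  also have "\<dots> \<le> card (c ` S)"
    using \<open>finite S\<close> by (intro card_image_le) auto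
  finally show thesis
    \<comment> \<open>The base vertex \<open>b\<close> serves as \<open>q\<close>: every vertex of a
      Kuhn simplex arises from it by raising some coordinates by one.\<close>
    using that[of b S] base_in_s \<open>finite S\<close> s_le_p base_le le_Suc_base by blast
qed

text \<open>The height \<open>2 * p\<close> keeps every point at distance at least \<open>p\<close>
  from the diagonal, and the spacing \<open>4 * p\<close> separates distinct indices. For
  \<open>x\<close> with values in \<open>{0..p}\<close>, neither is cheaper than moving a point
  along its own coordinate.\<close>

definition cube_diagram :: "nat \<Rightarrow> nat \<Rightarrow> (nat \<Rightarrow> nat) \<Rightarrow> nat diagram" where
  "cube_diagram n p x =
     (\<lambda>i. if i < n then Some (real (4 * p * i), real (4 * p * i + 2 * p + x i)) else None)"

lemma dom_cube_diagram: "dom (cube_diagram n p x) = {..<n}"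
  by (auto simp: cube_diagram_def dom_def)

lemma pt_cube_diagram:
  "i < n \<Longrightarrow> pt (cube_diagram n p x) i = (real (4 * p * i), real (4 * p * i + 2 * p + x i))"
  by (simp add: cube_diagram_def pt_def)

lemma d_inf_diag_cube_diagram:
  "i < n \<Longrightarrow> d_inf_diag (pt (cube_diagram n p x) i) = real p + real (x i) / 2"
  by (simp add: pt_cube_diagram d_inf_diag_eq)

lemma cube_diagram_finite:
  assumes "0 < p" and "\<forall>i. x i \<le> p"
  shows "cube_diagram n p x \<in> finite_diagrams"
proof -
  let ?D = "cube_diagram n p x" and ?E = "Map.empty :: nat diagram"
  have "persistence_diagram ?D"
    using \<open>0 < p\<close> unfolding persistence_diagram_def dom_cube_diagram
    by (auto simp: ran_def cube_diagram_def half_plane_def split: if_splits)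
  \<comment> \<open>The true distances to the diagonal are at most \<open>3 * p / 2\<close>;
    \<open>2 * p\<close> is a convenient rounding.\<close>
  moreover have "pre_bottleneck ?D ?E \<le> ennreal (real (2 * p))"
  proof (rule pre_bottleneck_le)
    show "partial_matching ?D ?E ({}, {}, id)"
      by (simp add: partial_matching_def)
    have "real (x i) \<le> real p" for i
      using assms(2) by simp
    then have "real p + real (x i) / 2 \<le> real (2 * p)" for i
      by (smt (verit) field_sum_of_halves of_nat_0_le_iff of_nat_add mult_2)
    then show "cost_inf ?D ?E ({}, {}, id) \<le> ennreal (real (2 * p))"
      unfolding cost_inf_le_iff dom_cube_diagram
      by (simp add: d_inf_diag_cube_diagram ennreal_leI del: ennreal_plus of_nat_mult)
  qed
  ultimately show ?thesis
    unfolding finite_diagrams_def by (auto intro: le_less_trans[OF _ ennreal_less_top])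
qed

text \<open>The identity matching moves only second coordinates, each by at most
  \<open>r\<close>.\<close>

lemma pre_bottleneck_cube_diagram_le:
  assumes "\<And>j. j < n \<Longrightarrow> \<bar>real (x j) - real (y j)\<bar> \<le> r"
  shows "pre_bottleneck (cube_diagram n p x) (cube_diagram n p y) \<le> ennreal r"
proof (rule pre_bottleneck_le)
  show "partial_matching (cube_diagram n p x) (cube_diagram n p y) ({..<n}, {..<n}, id)"
    by (simp add: partial_matching_def dom_cube_diagram)
  show "cost_inf (cube_diagram n p x) (cube_diagram n p y) ({..<n}, {..<n}, id) \<le> ennreal r"
    unfolding cost_inf_le_iff dom_cube_diagram
    using assms by (auto simp: pt_cube_diagram d_inf_def intro!: ennreal_leI)
qed

text \<open>In any matching, index \<open>j\<close> is unmatched at cost at least \<open>p\<close>,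
  matched to another index at cost at least \<open>4 * p\<close>, or matched to itself at cost at
  least the difference of the coordinates, which is itself at most \<open>p\<close>.\<close>

lemma pre_bottleneck_cube_diagram_ge:
  assumes "\<forall>i. x i \<le> p" "\<forall>i. y i \<le> p" and "j < n"
  shows "ennreal \<bar>real (x j) - real (y j)\<bar> \<le>
    pre_bottleneck (cube_diagram n p x) (cube_diagram n p y)"
  unfolding pre_bottleneck_def
proof (rule INF_greatest)
  let ?D = "cube_diagram n p x" and ?E = "cube_diagram n p y"
  fix m assume "m \<in> {m. partial_matching ?D ?E m}"
  then obtain A B f where m: "m = (A, B, f)" "A \<subseteq> {..<n}" "B \<subseteq> {..<n}" "bij_betw f A B"
    by (cases m) (auto simp: partial_matching_def dom_cube_diagram)
  have "cost_inf ?D ?E (A, B, f) \<le> cost_inf ?D ?E m"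
    using m(1) by simp
  note cost = this[unfolded cost_inf_le_iff dom_cube_diagram]
  have "real (x j) \<le> real p" "real (y j) \<le> real p"
    using assms by simp_all
  then have le_p: "\<bar>real (x j) - real (y j)\<bar> \<le> real p"
    by linarith
  show "ennreal \<bar>real (x j) - real (y j)\<bar> \<le> cost_inf ?D ?E m"
  proof (cases "j \<in> A")
    case False
    then have "ennreal (d_inf_diag (pt ?D j)) \<le> cost_inf ?D ?E m"
      using cost \<open>j < n\<close> by auto
    moreover have "\<bar>real (x j) - real (y j)\<bar> \<le> d_inf_diag (pt ?D j)"
      using le_p \<open>j < n\<close> by (simp add: d_inf_diag_cube_diagram)
    ultimately show ?thesis
      using ennreal_leI order_trans by blast
  next
    case True
    then have "f j < n"
      using m bij_betwE by blast
    have "\<bar>real (x j) - real (y j)\<bar> \<le> d_inf (pt ?D j) (pt ?E (f j))"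
    proof (cases "f j = j")
      case True
      then show ?thesis
        using \<open>j < n\<close> by (simp add: pt_cube_diagram d_inf_def)
    next
      case False
      then have "1 \<le> \<bar>real j - real (f j)\<bar>"
        by linarith
      then have "real (4 * p) * 1 \<le> real (4 * p) * \<bar>real j - real (f j)\<bar>"
        by (intro mult_left_mono) auto
      also have "\<dots> = \<bar>real (4 * p * j) - real (4 * p * f j)\<bar>"
        by (simp add: abs_mult flip: right_diff_distrib)
      also have "\<dots> \<le> d_inf (pt ?D j) (pt ?E (f j))"
        using \<open>j < n\<close> \<open>f j < n\<close> by (simp add: pt_cube_diagram d_inf_def)
      finally show ?thesis
        using le_p by simp
    qed
    moreover have "ennreal (d_inf (pt ?D j) (pt ?E (f j))) \<le> cost_inf ?D ?E m"
      using cost True by blast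
    ultimately show ?thesis
      using ennreal_leI order_trans by blast
  qed
qed

theorem corollary27:
  shows "\<not> (\<exists>n. Metric_space.asdim_le Dgm_inf bottleneck n)"
proof
  interpret Metric_space Dgm_inf bottleneck
    by (rule Metric_space_Dgm_inf)
  assume "\<exists>n. asdim_le n"
  then obtain n where "asdim_le n" ..
  \<comment> \<open>Balls are open, so a radius above 1 is taken to contain all points at distance
    at most 1 from the centre.\<close>
  then obtain \<U> where cover: "\<Union>\<U> = Dgm_inf"
    and multiplicity: "\<forall>X\<in>Dgm_inf. finite {U\<in>\<U>. U \<inter> mball X 2 \<noteq> {}} \<and>
         card {U\<in>\<U>. U \<inter> mball X 2 \<noteq> {}} \<le> n + 1"
    and diameter: "(SUP U\<in>\<U>. SUP x\<in>U. SUP y\<in>U. ennreal (bottleneck x y)) < \<infinity>" (is "?C < _")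
    unfolding asdim_le_def by (elim allE[of _ 2] impE exE conjE) simp_all
  obtain p :: nat where "?C < of_nat p"
    using diameter ennreal_Ex_less_of_nat by auto
  then have p: "?C < ennreal (real p)" "0 < p"
    by (auto simp: ennreal_of_nat_eq_real_of_nat intro!: gr0I)

  define D where "D = cube_diagram (Suc n) p"
  define F where "F = (\<lambda>x. diagram_rel `` {D x})"
  have D: "D x \<in> finite_diagrams" if "\<forall>i. x i \<le> p" for x
    using that p cube_diagram_finite by (simp add: D_def)
  have F: "F x \<in> Dgm_inf" if "\<forall>i. x i \<le> p" for x
    using D[OF that] by (simp add: F_def Dgm_inf_def quotientI)
  \<comment> \<open>Distances of finite diagrams are finite, so \<open>ennreal\<close> undoes the
    \<open>enn2real\<close> in \<open>bottleneck\<close>.\<close>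
  have dist: "ennreal (bottleneck (F x) (F y)) = pre_bottleneck (D x) (D y)"
    if "\<forall>i. x i \<le> p" "\<forall>i. y i \<le> p" for x y
    using that D pre_bottleneck_finite by (simp add: F_def bottleneck_class)
  have "\<exists>U\<in>\<U>. F x \<in> U" if "\<forall>i. x i \<le> p" for x
    using F[OF that] by (simp flip: cover)
  \<comment> \<open>The colour of a grid point is a set of the cover that contains its
    image.\<close>
  then obtain c where c: "\<And>x. \<forall>i. x i \<le> p \<Longrightarrow> c x \<in> \<U> \<and> F x \<in> c x"
    by metis
  have opposite: "c x \<noteq> c y"
    if "\<forall>i. x i \<le> p" "\<forall>i. y i \<le> p" "j < Suc n" "x j = 0" "y j = p" for x y j
  proof
    assume "c x = c y"
    then have "ennreal (bottleneck (F x) (F y)) \<le> ?C"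
      using c[OF that(1)] c[OF that(2)]
      by (intro SUP_upper2[of "c x"] SUP_upper2[of "F x"] SUP_upper2[of "F y"]) auto
    then show False
      using pre_bottleneck_cube_diagram_ge[OF that(1,2,3)] that(4,5) p(1) dist[OF that(1,2)]
      by (simp add: D_def)
  qed
  \<comment> \<open>With \<open>Suc n\<close> coordinates there are \<open>n + 2\<close> colours,
    one more than the multiplicity allows.\<close>
  obtain q S where S: "q \<in> S" "finite S" "\<And>x j. x \<in> S \<Longrightarrow> x j \<le> p"
    "\<And>x j. x \<in> S \<Longrightarrow> q j \<le> x j \<and> x j \<le> Suc (q j)" "Suc (Suc n) \<le> card (c ` S)"
    by (rule grid_covering[where c = c and n = "Suc n", OF \<open>0 < p\<close> opposite]) blast+
  have q: "\<forall>i. q i \<le> p"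
    using S by blast
  have "c ` S \<subseteq> {U\<in>\<U>. U \<inter> mball (F q) 2 \<noteq> {}}"
  proof
    fix U assume "U \<in> c ` S"
    then obtain x where x: "x \<in> S" "U = c x"
      by blast
    then have xp: "\<forall>i. x i \<le> p"
      using S by blast
    have "\<bar>real (q j) - real (x j)\<bar> \<le> 1" for j
      using S(4)[OF x(1), of j] by linarith
    then have "ennreal (bottleneck (F q) (F x)) \<le> ennreal 1"
      unfolding dist[OF q xp] D_def by (rule pre_bottleneck_cube_diagram_le)
    then have "bottleneck (F q) (F x) < 2"
      by (simp add: ennreal_le_1)
    then have "F x \<in> mball (F q) 2"
      using F q xp by simp
    then show "U \<in> {U\<in>\<U>. U \<inter> mball (F q) 2 \<noteq> {}}"
      using c[OF xp] x(2) by blast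
  qed
  then have "card (c ` S) \<le> n + 1"
    using bspec[OF multiplicity F[OF q]] by (blast intro: order_trans[OF card_mono])
  then show False
    using S(5) by simp
qed

end
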